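(* Let $f_{\mathrm{CRLB}}(\mathbf{X})=\sigma_{\mathrm r}^2\,\mathrm{tr}\big(\mathbf{F}_\vartheta(\mathbf{X})^{-1}\big)$ be the CRLB metric, defined for those $\mathbf{X}\in\mathbb{C}^{N\times\tau}$ for which $\mathbf{T}_\alpha^{\mathrm H}\tilde{\mathbf{X}}\mathbf{T}_\alpha$ and $\mathbf{F}_\vartheta(\mathbf{X})$ are invertible, where $\tilde{\mathbf{X}}=(\mathbf{X}^*\mathbf{X}^{\mathrm T})\otimes\mathbf{I}_N$ and $$\mathbf{F}_\vartheta(\mathbf{X})=\mathbf{T}_\vartheta^{\mathrm H}\tilde{\mathbf{X}}\mathbf{T}_\vartheta-\mathbf{T}_\vartheta^{\mathrm H}\tilde{\mathbf{X}}\mathbf{T}_\alpha\big(\mathbf{T}_\alpha^{\mathrm H}\tilde{\mathbf{X}}\mathbf{T}_\alpha\big)^{-1}\mathbf{T}_\alpha^{\mathrm H}\tilde{\mathbf{X}}\mathbf{T}_\vartheta .$$ Then for every such $\mathbf{X}$ and all $\varphi_1,\dots,\varphi_\tau\in\mathbb{R}$, with $\boldsymbol{\Omega}=\mathrm{diag}(e^{\mathrm{j}\varphi_1},\dots,e^{\mathrm{j}\varphi_\tau})$, one has $$f_{\mathrm{CRLB}}(\mathbf{X}\boldsymbol{\Omega})=f_{\mathrm{CRLB}}(\mathbf{X}).$$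
   Context: $N,\tau,K\ge1$ are integers, $\sigma_{\mathrm r}^2>0$ is the noise variance, and $\mathbf{a}:\mathbb{R}\to\mathbb{C}^N$ is a differentiable array steering vector. The target parameters are the amplitudes $\alpha_1,\dots,\alpha_K\in\mathbb{C}$ and the angles $\vartheta_1,\dots,\vartheta_K\in\mathbb{R}$, which are fixed. Put $\mathbf{g}=\mathrm{vec}\big(\sum_{k=1}^K\alpha_k\mathbf{a}(\vartheta_k)\mathbf{a}(\vartheta_k)^{\mathrm H}\big)\in\mathbb{C}^{N^2}$ (column stacking). The matrices $\mathbf{T}_\alpha,\mathbf{T}_\vartheta\in\mathbb{C}^{N^2\times K}$ are the blocks of the Jacobian $[\mathbf{T}_\alpha\ \mathbf{T}_\vartheta]$ of $\mathbf{g}$ with respect to $(\alpha_1,\dots,\alpha_K,\vartheta_1,\dots,\vartheta_K)$: the $k$-th column of $\mathbf{T}_\alpha$ is $\partial\mathbf{g}/\partial\alpha_k$ and the $k$-th column of $\mathbf{T}_\vartheta$ is $\partial\mathbf{g}/\partial\vartheta_k$. They do not depend on $\mathbf{X}$. Here $(\cdot)^*$, $(\cdot)^{\mathrm T}$, $(\cdot)^{\mathrm H}$ are conjugate, transpose and conjugate transpose, $\otimes$ is the Kronecker product, and $\mathrm{j}$ is the imaginary unit. *)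

theory Defs
  imports "HOL-Analysis.Analysis"
begin

(* N, tau and K are the cardinalities of the finite index types 'n, 't and 'k, so they are
   arbitrary integers >= 1.  Vectors in C^(N^2) are indexed by 'n \<times> 'n: the first component is
   the slow (block) index, the second one the fast index within a block. *)

definition cnj_mat :: "complex^'m^'n \<Rightarrow> complex^'m^'n" where
  "cnj_mat A = (\<chi> i j. cnj (A $ i $ j))"

definition herm :: "complex^'m^'n \<Rightarrow> complex^'n^'m" where
  "herm A = transpose (cnj_mat A)"

definition kron :: "complex^'m^'n \<Rightarrow> complex^'q^'p \<Rightarrow> complex^('m \<times> 'q)^('n \<times> 'p)" where
  "kron A B = (\<chi> r c. A $ fst r $ fst c * B $ snd r $ snd c)"

(* Column stacking: the block index is the column of A. *)
definition vec_stack :: "complex^'m^'n \<Rightarrow> complex^('m \<times> 'n)" where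
  "vec_stack A = (\<chi> p. A $ snd p $ fst p)"

definition diag_mat :: "complex^'n \<Rightarrow> complex^'n^'n" where
  "diag_mat d = (\<chi> i j. if i = j then d $ i else 0)"

definition target_response ::
  "(real \<Rightarrow> complex^'n) \<Rightarrow> complex^'k \<Rightarrow> real^'k \<Rightarrow> complex^'n^'n" where
  "target_response a \<alpha> \<theta> =
     (\<chi> i j. \<Sum>k\<in>UNIV. \<alpha> $ k * (a (\<theta> $ k) $ i * cnj (a (\<theta> $ k) $ j)))"

definition g_vec ::
  "(real \<Rightarrow> complex^'n) \<Rightarrow> complex^'k \<Rightarrow> real^'k \<Rightarrow> complex^('n \<times> 'n)" where
  "g_vec a \<alpha> \<theta> = vec_stack (target_response a \<alpha> \<theta>)"

definition vec_upd :: "'a^'k \<Rightarrow> 'k \<Rightarrow> 'a \<Rightarrow> 'a^'k" where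
  "vec_upd v k x = (\<chi> l. if l = k then x else v $ l)"

(* Complex partial derivatives: g is affine in each amplitude. *)
definition T_alpha ::
  "(real \<Rightarrow> complex^'n) \<Rightarrow> complex^'k \<Rightarrow> real^'k \<Rightarrow> complex^'k^('n \<times> 'n)" where
  "T_alpha a \<alpha> \<theta> =
     (\<chi> p k. deriv (\<lambda>z. g_vec a (vec_upd \<alpha> k z) \<theta> $ p) (\<alpha> $ k))"

(* Partial derivatives with respect to the real angles. *)
definition T_theta ::
  "(real \<Rightarrow> complex^'n) \<Rightarrow> complex^'k \<Rightarrow> real^'k \<Rightarrow> complex^'k^('n \<times> 'n)" where
  "T_theta a \<alpha> \<theta> =
     (\<chi> p k. vector_derivative (\<lambda>t. g_vec a \<alpha> (vec_upd \<theta> k t) $ p) (at (\<theta> $ k)))"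

definition X_tilde :: "complex^'t^'n \<Rightarrow> complex^('n \<times> 'n)^('n \<times> 'n)" where
  "X_tilde X = kron (cnj_mat X ** transpose X) (mat 1)"

definition F_alpha ::
  "(real \<Rightarrow> complex^'n) \<Rightarrow> complex^'k \<Rightarrow> real^'k \<Rightarrow> complex^'t^'n \<Rightarrow> complex^'k^'k" where
  "F_alpha a \<alpha> \<theta> X = herm (T_alpha a \<alpha> \<theta>) ** X_tilde X ** T_alpha a \<alpha> \<theta>"

definition F_theta ::
  "(real \<Rightarrow> complex^'n) \<Rightarrow> complex^'k \<Rightarrow> real^'k \<Rightarrow> complex^'t^'n \<Rightarrow> complex^'k^'k" where
  "F_theta a \<alpha> \<theta> X =
     herm (T_theta a \<alpha> \<theta>) ** X_tilde X ** T_theta a \<alpha> \<theta>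
     - herm (T_theta a \<alpha> \<theta>) ** X_tilde X ** T_alpha a \<alpha> \<theta>
       ** matrix_inv (F_alpha a \<alpha> \<theta> X)
       ** (herm (T_alpha a \<alpha> \<theta>) ** X_tilde X ** T_theta a \<alpha> \<theta>)"

definition crlb_domain ::
  "(real \<Rightarrow> complex^'n) \<Rightarrow> complex^'k \<Rightarrow> real^'k \<Rightarrow> (complex^'t^'n) set" where
  "crlb_domain a \<alpha> \<theta> =
     {X. invertible (F_alpha a \<alpha> \<theta> X) \<and> invertible (F_theta a \<alpha> \<theta> X)}"

(* The argument s2 is the noise variance.  Meaningful only on crlb_domain, since matrix_inv is
   unspecified on singular matrices. *)
definition f_CRLB ::
  "real \<Rightarrow> (real \<Rightarrow> complex^'n) \<Rightarrow> complex^'k \<Rightarrow> real^'k \<Rightarrow> complex^'t^'n \<Rightarrow> complex" where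
  "f_CRLB s2 a \<alpha> \<theta> X = of_real s2 * trace (matrix_inv (F_theta a \<alpha> \<theta> X))"

end

theory Submission
  imports Defs
begin

(* Multiplying column t of X by a phase leaves conj(X) X^T, the only quantity through which X
   enters the Fisher information, unchanged. *)

text \<open>Entry \<open>(i, k)\<close> of conj(X) X^T sums conj(x_ij) x_kj over the columns j, so
  each phase meets its own conjugate and cancels (\<open>cnj_mat_mult_transpose_phase\<close>).
  Hence \<open>F_alpha\<close> and \<open>F_theta\<close> are the same matrices for both arguments,
  and invertibility and trace carry over.\<close>

lemma mult_diag_mat_nth: "(X ** diag_mat d) $ i $ j = X $ i $ j * d $ j"
  by (simp add: matrix_matrix_mult_def diag_mat_def if_distrib cong: if_cong)

lemma cnj_mat_mult_transpose_phase:
  fixes X :: "complex^'t^'n"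
  assumes "\<And>j. norm (d $ j) = 1"
  shows "cnj_mat (X ** diag_mat d) ** transpose (X ** diag_mat d) = cnj_mat X ** transpose X"
proof -
  have "cnj (d $ j) * d $ j = 1" for j
    using assms[of j] by (simp add: complex_norm_square[symmetric] mult.commute)
  then have "cnj (X $ i $ j * d $ j) * (X $ k $ j * d $ j) = cnj (X $ i $ j) * X $ k $ j" for i j k
    by (metis (no_types, opaque_lifting) complex_cnj_mult mult.assoc mult.commute mult_1)
  then show ?thesis
    \<comment> \<open>The factors are rewritten entrywise by \<open>mult_diag_mat_nth\<close> while
      the outer product is still folded; unfolding it next exposes the summands.\<close>
    by (simp only: vec_eq_iff cnj_mat_def transpose_def mult_diag_mat_nth vec_lambda_beta)
      (simp only: matrix_matrix_mult_def vec_lambda_beta simp_thms)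
qed

theorem mainTheorem4:
  fixes \<sigma> :: real
    and a :: "real \<Rightarrow> complex^'n"
    and \<alpha> :: "complex^'k"
    and \<theta> :: "real^'k"
    and X :: "complex^'t^'n"
    and \<phi> :: "real^'t"
  assumes "\<sigma>\<^sup>2 > 0"
    and "\<forall>t. a differentiable (at t)"
    and "X \<in> crlb_domain a \<alpha> \<theta>"
  defines "\<Omega> \<equiv> diag_mat (\<chi> i. exp (\<i> * complex_of_real (\<phi> $ i)))"
  shows "X ** \<Omega> \<in> crlb_domain a \<alpha> \<theta> \<and>
         f_CRLB (\<sigma>\<^sup>2) a \<alpha> \<theta> (X ** \<Omega>) = f_CRLB (\<sigma>\<^sup>2) a \<alpha> \<theta> X"
proof -
  have Xt: "X_tilde (X ** \<Omega>) = X_tilde X"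
    \<comment> \<open>The unit-norm premise holds because the angles are real.\<close>
    unfolding X_tilde_def \<Omega>_def by (simp add: cnj_mat_mult_transpose_phase)
  have Fa: "F_alpha a \<alpha> \<theta> (X ** \<Omega>) = F_alpha a \<alpha> \<theta> X"
    by (simp add: F_alpha_def Xt)
  have Ft: "F_theta a \<alpha> \<theta> (X ** \<Omega>) = F_theta a \<alpha> \<theta> X"
    by (simp add: F_theta_def Xt Fa)
  show ?thesis
    using assms(3) by (simp add: crlb_domain_def f_CRLB_def Fa Ft)
qed

end
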